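(* For positive integers $p,q$ and an integer $n\ge 0$, the number $s_v(p,q,n)$ of vertex-labeled $p$-pure simplicial complexes with exactly $q$ facets and exactly $n$ vertices is $$s_v(p,q,n)=\sum_{k=0}^{n}(-1)^{k+n}\binom{n}{k}\binom{\binom{k}{p}}{q}.$$
   Context: A finite abstract simplicial complex is determined by its facets (inclusion-maximal faces), and its vertex set is the union of its facets. It is $p$-pure if every facet has cardinality $p$. A vertex-labeled complex with $n$ vertices has vertex set $[n]=\{1,\dots,n\}$, and two vertex-labeled complexes are the same only if they have the same set of facets. Thus $s_v(p,q,n)$ is the number of sets consisting of $q$ distinct $p$-element subsets of $[n]$ whose union is $[n]$. *)

theory Defs
  imports Main
begin

(* A complex is given by its set of faces, including the empty face.  The void complex {} (no
   faces, hence no facets) also satisfies this definition, but it is excluded as soon as a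
   positive number of facets is required. *)
definition abstract_simplicial_complex :: "'a set set \<Rightarrow> bool" where
  "abstract_simplicial_complex K \<longleftrightarrow>
     finite K \<and> (\<forall>F\<in>K. finite F) \<and> (\<forall>F\<in>K. \<forall>G. G \<subseteq> F \<longrightarrow> G \<in> K)"

definition facets :: "'a set set \<Rightarrow> 'a set set" where
  "facets K = {F \<in> K. \<forall>G\<in>K. F \<subseteq> G \<longrightarrow> G = F}"

definition vertices :: "'a set set \<Rightarrow> 'a set" where
  "vertices K = \<Union> (facets K)"

definition pure :: "nat \<Rightarrow> 'a set set \<Rightarrow> bool" where
  "pure p K \<longleftrightarrow> (\<forall>F \<in> facets K. card F = p)"

(* Labelled complexes are counted up to equality, not isomorphism.  The set below is finite
   (every such K is a subset of Pow {1..n}), so card is the true count. *)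
definition s_v :: "nat \<Rightarrow> nat \<Rightarrow> nat \<Rightarrow> nat" where
  "s_v p q n = card {K :: nat set set. abstract_simplicial_complex K \<and> vertices K = {1..n}
                       \<and> pure p K \<and> card (facets K) = q}"

end

theory Submission
  imports Defs "HOL-Library.FuncSet"
begin

text \<open>
  A complex is the family of all subsets of its facets, and every family of \<open>p\<close>-sets is an antichain;
  hence taking facets is a bijection from the \<open>p\<close>-pure complexes with \<open>q\<close> facets and vertex set \<open>S\<close>
  onto the sets of \<open>q\<close> distinct \<open>p\<close>-sets with union \<open>S\<close> (\<open>bij_betw_facets\<close>).

  The condition on the union is what makes counting these families hard. Without it, one counts
  all \<open>q\<close>-element families of \<open>p\<close>-subsets of \<open>S\<close>, of which there are \<open>(card S choose p) choose q\<close>.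
  Sorting them by their union \<open>T \<subseteq> S\<close> writes this number as a sum over the subsets of \<open>S\<close>
  (\<open>sum_card_pure_covers\<close>), and Moebius inversion on the Boolean lattice recovers the number of
  families with union exactly \<open>S\<close>. As the summand depends on \<open>T\<close> only through its cardinality,
  the alternating sum over subsets collapses to the sum over \<open>k\<close> with weights \<open>n choose k\<close>.
\<close>

definition pure_covers :: "nat \<Rightarrow> nat \<Rightarrow> 'a set \<Rightarrow> 'a set set set" where
  "pure_covers p q S = {A. A \<subseteq> {F. F \<subseteq> S \<and> card F = p} \<and> card A = q \<and> \<Union>A = S}"

text \<open>Finiteness of the complex enters here: it puts every face below a maximal one.\<close>

lemma Union_Pow_facets:
  assumes "abstract_simplicial_complex K"
  shows "\<Union> (Pow ` facets K) = K"
proof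
  show "\<Union> (Pow ` facets K) \<subseteq> K"
    using assms by (auto simp: abstract_simplicial_complex_def facets_def)
  show "K \<subseteq> \<Union> (Pow ` facets K)"
  proof
    fix F assume "F \<in> K"
    moreover have "finite K"
      using assms by (simp add: abstract_simplicial_complex_def)
    ultimately obtain G where "G \<in> K" "F \<subseteq> G" "\<forall>H\<in>K. G \<subseteq> H \<longrightarrow> H = G"
      using finite_has_maximal2[of K F] by metis
    then show "F \<in> \<Union> (Pow ` facets K)"
      by (auto simp: facets_def)
  qed
qed

text \<open>Sets of equal finite cardinality never contain each other properly, so none of the
  generators is lost as a facet.\<close>

lemma facets_Union_Pow:
  assumes "\<And>F. F \<in> A \<Longrightarrow> finite F \<and> card F = p"
  shows "facets (\<Union> (Pow ` A)) = A"
proof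
  show "facets (\<Union> (Pow ` A)) \<subseteq> A"
    by (auto simp: facets_def)
  show "A \<subseteq> facets (\<Union> (Pow ` A))"
  proof
    fix F assume F: "F \<in> A"
    have "G = F" if "H \<in> A" "G \<subseteq> H" "F \<subseteq> G" for G H
      using that F assms[of F] assms[of H] card_subset_eq[of H F] by auto
    with F show "F \<in> facets (\<Union> (Pow ` A))"
      by (auto simp: facets_def)
  qed
qed

lemma bij_betw_facets:
  assumes "finite S"
  shows "bij_betw facets
    {K. abstract_simplicial_complex K \<and> vertices K = S \<and> pure p K \<and> card (facets K) = q}
    (pure_covers p q S)"
proof (rule bij_betwI[where g = "\<lambda>A. \<Union> (Pow ` A)"])
  show "facets \<in> {K. abstract_simplicial_complex K \<and> vertices K = S \<and> pure p K
      \<and> card (facets K) = q} \<rightarrow> pure_covers p q S"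
    by (auto simp: pure_covers_def vertices_def pure_def)
  have fac: "facets (\<Union> (Pow ` A)) = A" if "A \<in> pure_covers p q S" for A
    using that assms by (intro facets_Union_Pow[of _ p]) (auto simp: pure_covers_def intro: finite_subset)
  then show "facets (\<Union> (Pow ` A)) = A" if "A \<in> pure_covers p q S" for A
    using that .
  have complex: "abstract_simplicial_complex (\<Union> (Pow ` A))" if "A \<in> pure_covers p q S" for A
  proof -
    have sub: "\<Union> (Pow ` A) \<subseteq> Pow S"
      using that by (auto simp: pure_covers_def)
    then have "finite (\<Union> (Pow ` A))" "\<forall>F\<in>\<Union> (Pow ` A). finite F"
      using assms by (meson finite_Pow_iff finite_subset, meson PowD assms finite_subset subsetD)
    then show ?thesis
      unfolding abstract_simplicial_complex_def by blast
  qed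
  show "(\<lambda>A. \<Union> (Pow ` A)) \<in> pure_covers p q S \<rightarrow>
      {K. abstract_simplicial_complex K \<and> vertices K = S \<and> pure p K \<and> card (facets K) = q}"
  proof
    fix A assume A: "A \<in> pure_covers p q S"
    have "vertices (\<Union> (Pow ` A)) = S" "pure p (\<Union> (Pow ` A))" "card (facets (\<Union> (Pow ` A))) = q"
      unfolding vertices_def pure_def fac[OF A] using A by (auto simp: pure_covers_def)
    with complex[OF A] show "\<Union> (Pow ` A) \<in>
        {K. abstract_simplicial_complex K \<and> vertices K = S \<and> pure p K \<and> card (facets K) = q}"
      by blast
  qed
  show "\<Union> (Pow ` facets K) = K"
    if "K \<in> {K. abstract_simplicial_complex K \<and> vertices K = S \<and> pure p K \<and> card (facets K) = q}"
    for K
    using that Union_Pow_facets by blast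
qed

text \<open>Both sides count the \<open>q\<close>-element families of \<open>p\<close>-subsets of \<open>S\<close>, on the left
  sorted by their union.\<close>

lemma sum_card_pure_covers:
  assumes "finite S"
  shows "(\<Sum>T\<in>Pow S. card (pure_covers p q T)) = (card S choose p) choose q"
proof -
  let ?X = "{F. F \<subseteq> S \<and> card F = p}"
  let ?Y = "{A. A \<subseteq> ?X \<and> card A = q}"
  have finX: "finite ?X" and finY: "finite ?Y"
    using assms by auto
  have "pure_covers p q T = {A \<in> ?Y. \<Union>A = T}" if "T \<in> Pow S" for T
    using that by (auto simp: pure_covers_def)
  then have "(\<Sum>T\<in>Pow S. card (pure_covers p q T)) = (\<Sum>T\<in>Pow S. \<Sum>A\<in>{A \<in> ?Y. \<Union>A = T}. 1)"
    by (intro sum.cong) auto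
  also have "\<dots> = (\<Sum>A\<in>?Y. 1)"
    using assms finY by (intro sum.group) auto
  also have "\<dots> = (card S choose p) choose q"
    using n_subsets[OF finX, of q] n_subsets[OF assms, of p] by simp
  finally show ?thesis .
qed

lemma sum_Pow_card:
  fixes h :: "nat \<Rightarrow> 'b::semiring_1"
  assumes "finite S"
  shows "(\<Sum>T\<in>Pow S. h (card T)) = (\<Sum>k = 0..card S. of_nat (card S choose k) * h k)"
proof -
  have "(\<Sum>T\<in>Pow S. h (card T)) = (\<Sum>k = 0..card S. \<Sum>T\<in>{T \<in> Pow S. card T = k}. h (card T))"
    using assms by (intro sum.group[symmetric]) (auto intro: card_mono)
  also have "\<dots> = (\<Sum>k = 0..card S. of_nat (card S choose k) * h k)"
    using n_subsets[OF assms] by (intro sum.cong) auto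
  finally show ?thesis .
qed

theorem proposition4p1:
  fixes p q n :: nat
  assumes "p > 0" and "q > 0"
  shows "int (s_v p q n) =
    (\<Sum>k = 0..n. (-1) ^ (k + n) * int (n choose k) * int ((k choose p) choose q))"
proof -
  let ?S = "{1..n}"
  have "int (s_v p q n) = int (card (pure_covers p q ?S))"
    unfolding s_v_def by (simp add: bij_betw_same_card[OF bij_betw_facets])
  also have "\<dots> = (\<Sum>T\<in>Pow ?S. (-1) ^ (card ?S - card T) * int ((card T choose p) choose q))"
    by (rule inclusion_exclusion_mobius) (simp_all flip: sum_card_pure_covers)
  also have "\<dots> = (\<Sum>k = 0..n. int (n choose k) * ((-1) ^ (n - k) * int ((k choose p) choose q)))"
    using sum_Pow_card[of ?S "\<lambda>k. (-1) ^ (n - k) * int ((k choose p) choose q)"] by simp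
  also have "\<dots> = (\<Sum>k = 0..n. (-1) ^ (k + n) * int (n choose k) * int ((k choose p) choose q))"
    by (intro sum.cong) (simp_all add: neg_one_power_add_eq_neg_one_power_diff add.commute[of _ n])
  finally show ?thesis .
qed

end
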